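(* Let $\mathbf{A}=[\underline{A},\overline{A}]$ be an $n\times n$ real interval matrix that is diagonally interval and whose midpoint $A^c$ is symmetric. Then $\lambda_i(\mathbf{A}^S)=[\lambda_i(\underline{A}),\lambda_i(\overline{A})]$ for every $i=1,\dots,n$.
   Context: Inequalities between matrices are entrywise. For $\underline{A}\le\overline{A}$ in $\mathbb{R}^{n\times n}$, the interval matrix is $\mathbf{A}=\{A\in\mathbb{R}^{n\times n} : \underline{A}\le A\le\overline{A}\}$, with midpoint $A^c=\frac12(\underline{A}+\overline{A})$ and radius $A^\Delta=\frac12(\overline{A}-\underline{A})$. $\mathbf{A}$ is diagonally interval if $A^\Delta$ is a diagonal matrix. $\mathbf{A}^S=\{A\in\mathbf{A} : A=A^T\}$. For a symmetric matrix $A$, its eigenvalues are ordered $\lambda_1(A)\ge\dots\ge\lambda_n(A)$, and $\lambda_i(\mathbf{A}^S)=\{\lambda_i(A) : A\in\mathbf{A}^S\}$. *)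

theory Defs
  imports
    "HOL-Computational_Algebra.Computational_Algebra"
    "Jordan_Normal_Form.Char_Poly"
begin

(* The order on matrices is entrywise and relates only matrices of equal dimensions,
   so for n x n matrices L \<le> U the interval matrix [L, U] is the order interval {L..U}. *)

definition midpoint_mat :: "real mat \<Rightarrow> real mat \<Rightarrow> real mat" where
  "midpoint_mat L U = (1/2) \<cdot>\<^sub>m (L + U)"

definition radius_mat :: "real mat \<Rightarrow> real mat \<Rightarrow> real mat" where
  "radius_mat L U = (1/2) \<cdot>\<^sub>m (U - L)"

definition symmetric_mat :: "real mat \<Rightarrow> bool" where
  "symmetric_mat A \<longleftrightarrow> A = transpose_mat A"

definition diagonally_interval :: "real mat \<Rightarrow> real mat \<Rightarrow> bool" where
  "diagonally_interval L U \<longleftrightarrow> diagonal_mat (radius_mat L U)"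

definition sym_part :: "real mat set \<Rightarrow> real mat set" where
  "sym_part \<A> = {A \<in> \<A>. symmetric_mat A}"

(* The roots of the characteristic polynomial, repeated according to multiplicity, in
   decreasing order. Only meant for symmetric n x n matrices, all of whose n eigenvalues
   are real. The index is 1-based: eigval 1 A \<ge> ... \<ge> eigval n A. *)
definition eigval :: "nat \<Rightarrow> real mat \<Rightarrow> real" where
  "eigval i A = rev (sorted_list_of_multiset (proots (char_poly A))) ! (i - 1)"

end

(* The off-diagonal part is the same for all members of the interval matrix, so L, U and every
   symmetric member A differ only by nonnegative diagonal matrices. By the Courant-Fischer argument
   an eigenvalue cannot decrease when a positive semidefinite matrix is added, which places every
   eigenvalue of A between those of L and U. Along the segment from L to U the eigenvalue is
   Lipschitz continuous, because the same argument bounds its growth by the largest shift of the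
   quadratic form; hence every intermediate value is attained. *)

theory Submission
  imports Defs "Jordan_Normal_Form.Schur_Decomposition"
begin

unbundle no fps_syntax

section \<open>Real spectrum of symmetric matrices\<close>

lemma conjugate_real_vec [simp]: "conjugate (v :: real vec) = v"
  by (rule eq_vecI) auto

lemma scalar_prod_self_pos:
  fixes v :: "real vec"
  assumes "v \<in> carrier_vec n" "v \<noteq> 0\<^sub>v n"
  shows "v \<bullet> v > 0"
  using conjugate_square_greater_0_vec[OF assms(1)] assms(2) by simp

lemma symmetric_mat_index:
  assumes "A \<in> carrier_mat n n"
  shows "symmetric_mat A \<longleftrightarrow> (\<forall>i<n. \<forall>j<n. A $$ (i, j) = A $$ (j, i))"
proof
  assume "symmetric_mat A"
  then have *: "A = transpose_mat A" by (simp add: symmetric_mat_def)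
  show "\<forall>i<n. \<forall>j<n. A $$ (i, j) = A $$ (j, i)"
    using assms by (subst *) auto
next
  assume "\<forall>i<n. \<forall>j<n. A $$ (i, j) = A $$ (j, i)"
  then show "symmetric_mat A"
    unfolding symmetric_mat_def using assms by (intro eq_matI) auto
qed

text \<open>For an eigenvector \<open>v\<close>, symmetry moves the matrix to the other side of the
  pairing and real entries let it pass through the conjugation. This gives
  \<open>k * (v \<bullet>c v) = cnj k * (v \<bullet>c v)\<close>, and the pairing is
  nonzero.\<close>

lemma symmetric_mat_eigenvalue_real:
  assumes A: "A \<in> carrier_mat n n" and sym: "symmetric_mat A"
    and ev: "eigenvalue (map_mat complex_of_real A) k"
  shows "k \<in> \<real>"
proof -
  let ?C = "map_mat complex_of_real A"
  have C: "?C \<in> carrier_mat n n" using A by simp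
  have tC: "transpose_mat ?C = ?C"
    using symmetric_mat_index[OF A] sym A by (intro eq_matI) auto
  from ev obtain v where v: "v \<in> carrier_vec n" and v0: "v \<noteq> 0\<^sub>v n" and Cv: "?C *\<^sub>v v = k \<cdot>\<^sub>v v"
    unfolding eigenvalue_def eigenvector_def using A by auto
  have conjC: "conjugate (?C *\<^sub>v v) = ?C *\<^sub>v conjugate v"
    using A v by (intro eq_vecI) (auto simp: scalar_prod_def)
  have cv: "conjugate v \<in> carrier_vec n" using v by simp
  have "k * (v \<bullet>c v) = (?C *\<^sub>v v) \<bullet>c v"
    using v by (simp add: Cv)
  also have "\<dots> = v \<bullet> (?C *\<^sub>v conjugate v)"
    using transpose_vec_mult_scalar[OF C cv v] tC C v cv
    by (metis mult_mat_vec_carrier comm_scalar_prod)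
  also have "\<dots> = v \<bullet>c (k \<cdot>\<^sub>v v)"
    by (simp add: conjC[symmetric] Cv)
  also have "\<dots> = cnj k * (v \<bullet>c v)"
    using v by (simp add: conjugate_smult_vec)
  finally have "k = cnj k"
    using v v0 by simp
  then show ?thesis by (simp add: Reals_cnj_iff)
qed

text \<open>Over the complex numbers the characteristic polynomial splits into \<open>n\<close>
  linear factors. Their roots are eigenvalues, hence real, and injectivity of the coefficient
  embedding brings the factorization back to the reals.\<close>

lemma symmetric_mat_char_poly_splits:
  assumes A: "A \<in> carrier_mat n n" and sym: "symmetric_mat A"
  shows "\<exists>es. char_poly A = (\<Prod>e\<leftarrow>es. [:- e, 1:]) \<and> length es = n"
proof -
  let ?C = "map_mat complex_of_real A"
  have C: "?C \<in> carrier_mat n n" using A by simp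
  obtain as where as: "char_poly ?C = (\<Prod>a\<leftarrow>as. [:- a, 1:])" "length as = n"
    using char_poly_factorized[OF C] by blast
  have "a \<in> \<real>" if "a \<in> set as" for a
  proof -
    have "poly (char_poly ?C) a = 0"
      unfolding as(1) using that by (auto simp: poly_prod_list prod_list_zero_iff)
    then show ?thesis
      using eigenvalue_root_char_poly[OF C] symmetric_mat_eigenvalue_real[OF A sym] by blast
  qed
  then have as_eq: "as = map (\<lambda>a. complex_of_real (Re a)) as"
    by (intro map_idI[symmetric]) auto
  interpret h: map_poly_inj_idom_hom complex_of_real ..
  have "map_poly complex_of_real (char_poly A) = char_poly ?C"
    by (rule of_real_hom.char_poly_hom[OF A, symmetric])
  also have "\<dots> = (\<Prod>a\<leftarrow>as. [:- complex_of_real (Re a), 1:])"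
    unfolding as(1) by (subst as_eq) (simp add: o_def)
  also have "\<dots> = map_poly complex_of_real (\<Prod>e\<leftarrow>map Re as. [:- e, 1:])"
    by (simp add: h.hom_prod_list o_def)
  finally have "char_poly A = (\<Prod>e\<leftarrow>map Re as. [:- e, 1:])"
    by simp
  with as(2) show ?thesis by (intro exI[of _ "map Re as"]) simp
qed

section \<open>Orthogonal diagonalization\<close>

lemma orthogonal_mat_with_first_col:
  fixes v :: "real vec"
  assumes v: "v \<in> carrier_vec n" and v0: "v \<noteq> 0\<^sub>v n" and n: "n > 0"
  shows "\<exists>W c. W \<in> carrier_mat n n \<and> transpose_mat W * W = 1\<^sub>m n \<and> col W 0 = c \<cdot>\<^sub>v v"
proof -
  interpret cof_vec_space n "TYPE(real)" .
  define ws where "ws = gram_schmidt n (basis_completion v)"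
  note bc = basis_completion[OF v v0]
  note gs = gram_schmidt_result[OF bc(2) bc(4) bc(5) ws_def]
  have len: "length ws = n" using gs bc by simp
  \<comment> \<open>Gram-Schmidt leaves the first vector of the completed basis unchanged, so
    normalizing later only rescales \<open>v\<close>.\<close>
  have hd: "ws ! 0 = v"
  proof -
    obtain vs where "basis_completion v = v # vs"
      using bc(6,7) n by (cases "basis_completion v") auto
    then show ?thesis
      using gram_schmidt_hd[OF v, of vs] len n unfolding ws_def by (metis hd_conv_nth length_greater_0_conv)
  qed
  \<comment> \<open>The Gram-Schmidt vectors are orthogonal but not of unit length; dividing by the
    norms makes the columns orthonormal.\<close>
  define W where "W = mat_of_cols n (map (\<lambda>w. (1 / sqrt (w \<bullet> w)) \<cdot>\<^sub>v w) ws)"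
  have W: "W \<in> carrier_mat n n" unfolding W_def using len by auto
  have wi: "ws ! i \<in> carrier_vec n" if "i < n" for i
    using gs(3) len that by auto
  have colW: "col W i = (1 / sqrt (ws ! i \<bullet> ws ! i)) \<cdot>\<^sub>v (ws ! i)" if "i < n" for i
    unfolding W_def using that len wi by (subst col_mat_of_cols) auto
  have "transpose_mat W * W = 1\<^sub>m n"
  proof (rule eq_matI)
    fix i j assume ij: "i < dim_row (1\<^sub>m n :: real mat)" "j < dim_col (1\<^sub>m n :: real mat)"
    then have ij: "i < n" "j < n" by auto
    let ?a = "ws ! i" and ?b = "ws ! j"
    have "(transpose_mat W * W) $$ (i, j) = col W i \<bullet> col W j"
      using W ij by simp
    also have "\<dots> = (?a \<bullet> ?b) / (sqrt (?a \<bullet> ?a) * sqrt (?b \<bullet> ?b))"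
      using scalar_prod_smult_distrib[OF iffD2[OF smult_carrier_vec wi[OF ij(1)]] wi[OF ij(2)]]
        smult_scalar_prod_distrib[OF wi[OF ij(1)] wi[OF ij(2)]]
      by (simp add: colW ij)
    also have "\<dots> = 1\<^sub>m n $$ (i, j)"
    proof (cases "i = j")
      case True
      have "?a \<bullet> ?a \<noteq> 0" using corthogonalD[OF gs(2), of i i] ij len by simp
      moreover have "?a \<bullet> ?a \<ge> 0" using conjugate_square_ge_0_vec[of ?a] by simp
      ultimately show ?thesis using True ij by simp
    next
      case False
      then show ?thesis using corthogonalD[OF gs(2), of i j] ij len by simp
    qed
    finally show "(transpose_mat W * W) $$ (i, j) = 1\<^sub>m n $$ (i, j)" .
  qed (use W in auto)
  then show ?thesis using W colW[OF n] hd by metis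
qed

lemma block_diag_mult:
  fixes A1 A2 B1 B2 :: "'a :: semiring_0 mat"
  assumes "A1 \<in> carrier_mat k k" "A2 \<in> carrier_mat m m"
    and "B1 \<in> carrier_mat k k" "B2 \<in> carrier_mat m m"
  shows "four_block_mat A1 (0\<^sub>m k m) (0\<^sub>m m k) A2 * four_block_mat B1 (0\<^sub>m k m) (0\<^sub>m m k) B2 =
    four_block_mat (A1 * B1) (0\<^sub>m k m) (0\<^sub>m m k) (A2 * B2)"
  using assms by (subst mult_four_block_mat[of _ k k _ m _ m _ _ k _ m]) auto

text \<open>Deflation by induction on the list of roots: an orthogonal change of basis starting with
  an eigenvector for the head \<open>e\<close> splits off a 1 x 1 block, and the other block is
  symmetric with the tail as its roots. Since \<open>es\<close> may list the roots in any order, the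
  diagonal can later be taken decreasing.\<close>

theorem symmetric_mat_diagonalization:
  assumes "A \<in> carrier_mat n n" "symmetric_mat A" "length es = n"
    and "char_poly A = (\<Prod>e\<leftarrow>es. [:- e, 1:])"
  shows "\<exists>P. P \<in> carrier_mat n n \<and> transpose_mat P * P = 1\<^sub>m n \<and>
    transpose_mat P * A * P = mat_diag n ((!) es)"
  using assms
proof (induction es arbitrary: A n)
  case Nil
  then show ?case by (intro exI[of _ "1\<^sub>m 0"]) (auto simp: mat_diag_def intro!: eq_matI)
next
  case (Cons e es A n)
  note A = Cons.prems(1) and sym = Cons.prems(2)
  let ?m = "length es"
  have n: "n = Suc ?m" using Cons.prems(3) by simp
  have "eigenvalue A e"
    unfolding eigenvalue_root_char_poly[OF A] Cons.prems(4) by simp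
  then obtain v where v: "v \<in> carrier_vec n" and v0: "v \<noteq> 0\<^sub>v n" and Av: "A *\<^sub>v v = e \<cdot>\<^sub>v v"
    unfolding eigenvalue_def eigenvector_def using A by auto
  obtain W c where W: "W \<in> carrier_mat n n" and WW: "transpose_mat W * W = 1\<^sub>m n"
    and W0: "col W 0 = c \<cdot>\<^sub>v v"
    using orthogonal_mat_with_first_col[OF v v0] n by auto
  let ?Wt = "transpose_mat W"
  have Wt: "?Wt \<in> carrier_mat n n" using W by simp
  have WW': "W * ?Wt = 1\<^sub>m n" using mat_mult_left_right_inverse[OF Wt W WW] .
  define A' where "A' = ?Wt * A * W"
  have A': "A' \<in> carrier_mat n n" unfolding A'_def using A W by simp
  have tA: "transpose_mat A = A" using sym by (simp add: symmetric_mat_def)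
  have "transpose_mat A' = A'"
    unfolding A'_def using A W Wt
    by (simp add: tA transpose_mult[of _ n n _ n] assoc_mult_mat[of _ n n _ n _ n])
  then have symA': "A' $$ (i, j) = A' $$ (j, i)" if "i < n" "j < n" for i j
    using symmetric_mat_index[OF A'] that by (metis symmetric_mat_def)
  \<comment> \<open>The first column of \<open>W\<close> is an \<open>e\<close>-eigenvector, so the
    first column of \<open>A'\<close> is \<open>e\<close> times that of \<open>?Wt * W\<close>, the
    identity. Symmetry then clears the first row as well.\<close>
  have col0: "A' $$ (i, 0) = (if i = 0 then e else 0)" if i: "i < n" for i
  proof -
    have AW0: "A *\<^sub>v col W 0 = e \<cdot>\<^sub>v col W 0"
      using A v by (simp add: W0 Av mult_mat_vec smult_smult_assoc mult.commute)
    have "A' $$ (i, 0) = (?Wt * (A * W)) $$ (i, 0)"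
      unfolding A'_def using A W Wt by (simp add: assoc_mult_mat[of _ n n _ n _ n])
    also have "\<dots> = row ?Wt i \<bullet> (A *\<^sub>v col W 0)"
      using A W Wt i n col_mult2[OF A W, of 0] by (simp del: col_mult2)
    also have "\<dots> = e * (row ?Wt i \<bullet> col W 0)"
      unfolding AW0 using W i by simp
    also have "row ?Wt i \<bullet> col W 0 = (?Wt * W) $$ (i, 0)"
      using W i n by simp
    finally show ?thesis using i n by (simp add: WW)
  qed
  define A3 where "A3 = mat ?m ?m (\<lambda>(i, j). A' $$ (Suc i, Suc j))"
  have A3: "A3 \<in> carrier_mat ?m ?m" unfolding A3_def by simp
  let ?E = "mat 1 1 (\<lambda>_. e)"
  have blocks: "A' = four_block_mat ?E (0\<^sub>m 1 ?m) (0\<^sub>m ?m 1) A3"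
  proof (rule eq_matI)
    fix i j
    assume "i < dim_row (four_block_mat ?E (0\<^sub>m 1 ?m) (0\<^sub>m ?m 1) A3)"
      "j < dim_col (four_block_mat ?E (0\<^sub>m 1 ?m) (0\<^sub>m ?m 1) A3)"
    then have ij: "i < n" "j < n" using n A3 by auto
    then show "A' $$ (i, j) = four_block_mat ?E (0\<^sub>m 1 ?m) (0\<^sub>m ?m 1) A3 $$ (i, j)"
      using col0[of i] col0[of j] symA'[of 0 j] n A3
      by (cases i; cases j) (auto simp: A3_def)
  qed (use A' A3 n in auto)
  have symA3: "symmetric_mat A3"
    unfolding symmetric_mat_index[OF A3] using symA' n by (auto simp: A3_def)
  \<comment> \<open>Similarity preserves the characteristic polynomial and the block form factors
    it; cancelling the factor of \<open>e\<close> leaves exactly the induction hypothesis for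
    \<open>A3\<close>.\<close>
  have "similar_mat_wit A' A ?Wt W"
    by (rule similar_mat_witI[of _ _ n]) (use A A' W WW WW' A'_def in auto)
  then have "char_poly A' = char_poly A"
    using char_poly_similar unfolding similar_mat_def by blast
  moreover have "char_poly A' = char_poly ?E * char_poly A3"
    unfolding blocks by (rule char_poly_four_block_zeros_col) (use A3 in auto)
  moreover have "char_poly ?E = [:- e, 1:]"
    by (simp add: char_poly_defs det_def sign_def)
  ultimately have "[:- e, 1:] * char_poly A3 = [:- e, 1:] * (\<Prod>e\<leftarrow>es. [:- e, 1:])"
    using Cons.prems(4) by simp
  then have "char_poly A3 = (\<Prod>e\<leftarrow>es. [:- e, 1:])"
    by (metis mult_cancel_left pCons_eq_0_iff zero_neq_one)
  from Cons.IH[OF A3 symA3 refl this] obtain P3 where P3: "P3 \<in> carrier_mat ?m ?m"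
    and P3P3: "transpose_mat P3 * P3 = 1\<^sub>m ?m"
    and diag: "transpose_mat P3 * A3 * P3 = mat_diag ?m ((!) es)" by blast
  \<comment> \<open>The diagonalizing matrix of the smaller block is padded by a 1 that fixes the
    first coordinate; \<open>W * F\<close> then diagonalizes \<open>A\<close>.\<close>
  define F where "F = four_block_mat (1\<^sub>m 1) (0\<^sub>m 1 ?m) (0\<^sub>m ?m 1) P3"
  have F: "F \<in> carrier_mat n n" unfolding F_def using P3 n by auto
  have tF: "transpose_mat F = four_block_mat (1\<^sub>m 1) (0\<^sub>m 1 ?m) (0\<^sub>m ?m 1) (transpose_mat P3)"
    unfolding F_def using P3 by (subst transpose_four_block_mat) auto
  have FF: "transpose_mat F * F = 1\<^sub>m n"
    unfolding tF n unfolding F_def using P3 by (simp add: block_diag_mult[of _ "Suc 0" _ ?m] P3P3)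
  have "transpose_mat F * A' * F =
      four_block_mat ?E (0\<^sub>m 1 ?m) (0\<^sub>m ?m 1) (transpose_mat P3 * A3 * P3)"
    unfolding tF blocks unfolding F_def using P3 A3
    by (simp add: block_diag_mult[of _ "Suc 0" _ ?m])
  also have "\<dots> = mat_diag n ((!) (e # es))"
    unfolding diag mat_diag_def using n
    by (intro eq_matI) (auto simp: nth_Cons split: nat.splits)
  finally have D: "transpose_mat F * A' * F = mat_diag n ((!) (e # es))" .
  have tF': "transpose_mat F \<in> carrier_mat n n" using F by simp
  show ?case
  proof (intro exI[of _ "W * F"] conjI)
    show "W * F \<in> carrier_mat n n" using W F by simp
    have t: "transpose_mat (W * F) = transpose_mat F * ?Wt"
      using W F by (rule transpose_mult)
    have "transpose_mat (W * F) * (W * F) = transpose_mat F * (?Wt * W) * F"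
      unfolding t using W Wt F tF' by (simp add: assoc_mult_mat[of _ n n _ n _ n])
    then show "transpose_mat (W * F) * (W * F) = 1\<^sub>m n"
      using WW FF F by simp
    have "transpose_mat (W * F) * A * (W * F) = transpose_mat F * A' * F"
      unfolding t A'_def using W Wt F tF' A by (simp add: assoc_mult_mat[of _ n n _ n _ n])
    then show "transpose_mat (W * F) * A * (W * F) = mat_diag n ((!) (e # es))"
      using D by simp
  qed
qed

section \<open>Ordered eigenvalues and the quadratic form\<close>

lemma eigval_diagonalization:
  assumes A: "A \<in> carrier_mat n n" and sym: "symmetric_mat A"
  shows "\<exists>P. P \<in> carrier_mat n n \<and> transpose_mat P * P = 1\<^sub>m n \<and>
      transpose_mat P * A * P = mat_diag n (\<lambda>j. eigval (Suc j) A)"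
    and "\<And>i j. 1 \<le> i \<Longrightarrow> i \<le> j \<Longrightarrow> j \<le> n \<Longrightarrow> eigval j A \<le> eigval i A"
proof -
  obtain as where as: "char_poly A = (\<Prod>e\<leftarrow>as. [:- e, 1:])" "length as = n"
    using symmetric_mat_char_poly_splits[OF A sym] by blast
  \<comment> \<open>The roots with multiplicity are the splitting list up to order, so
    \<open>eigval\<close> reads off its decreasing rearrangement.\<close>
  have "proots (\<Prod>e\<leftarrow>as. [:- e, 1:]) = mset as"
  proof (induction as)
    case (Cons a as)
    have "(\<Prod>e\<leftarrow>as. [:- e, 1:]) \<noteq> 0" by (auto simp: prod_list_zero_iff)
    then have "proots ([:- a, 1:] * (\<Prod>e\<leftarrow>as. [:- e, 1:])) = add_mset a (mset as)"
      by (subst proots_mult) (auto simp: Cons.IH)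
    then show ?case by (simp only: list.map prod_list.Cons mset.simps)
  qed simp
  then have proots: "proots (char_poly A) = mset as" using as by simp
  define es where "es = rev (sort as)"
  have eig: "eigval i A = es ! (i - 1)" for i
    unfolding eigval_def proots es_def by simp
  have len: "length es = n" using as(2) by (simp add: es_def)
  have "mset es = mset as" by (simp add: es_def)
  then have "(\<Prod>e\<leftarrow>es. [:- e, 1:]) = (\<Prod>e\<leftarrow>as. [:- e, 1:])"
    by (metis mset_map prod_mset_prod_list)
  with as(1) have "char_poly A = (\<Prod>e\<leftarrow>es. [:- e, 1:])" by simp
  from symmetric_mat_diagonalization[OF A sym len this]
  show "\<exists>P. P \<in> carrier_mat n n \<and> transpose_mat P * P = 1\<^sub>m n \<and>
      transpose_mat P * A * P = mat_diag n (\<lambda>j. eigval (Suc j) A)"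
    by (simp add: eig)
  fix i j assume ij: "1 \<le> i" "i \<le> j" "j \<le> n"
  have "sorted_wrt (\<ge>) es" by (simp add: es_def sorted_wrt_rev)
  then show "eigval j A \<le> eigval i A"
    unfolding eig using ij len sorted_wrt_nth_less[of "(\<ge>)" es "i - 1" "j - 1"]
    by (cases "i = j") auto
qed

text \<open>In coordinates with respect to an orthonormal eigenbasis the form is a sum of squares
  weighted by the eigenvalues. This is the shape needed for bounding it on spans of
  eigenvectors.\<close>

lemma quadratic_form_eigval:
  assumes A: "A \<in> carrier_mat n n" and sym: "symmetric_mat A"
  shows "\<exists>P. P \<in> carrier_mat n n \<and>
    (\<forall>x \<in> carrier_vec n. x \<bullet> x = (\<Sum>j<n. ((P *\<^sub>v x) $ j)\<^sup>2) \<and>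
       x \<bullet> (A *\<^sub>v x) = (\<Sum>j<n. eigval (Suc j) A * ((P *\<^sub>v x) $ j)\<^sup>2))"
proof -
  obtain P where P: "P \<in> carrier_mat n n" and PP: "transpose_mat P * P = 1\<^sub>m n"
    and D: "transpose_mat P * A * P = mat_diag n (\<lambda>j. eigval (Suc j) A)"
    using eigval_diagonalization(1)[OF A sym] by blast
  let ?Pt = "transpose_mat P"
  let ?D = "mat_diag n (\<lambda>j. eigval (Suc j) A)"
  have Pt: "?Pt \<in> carrier_mat n n" using P by simp
  have PP': "P * ?Pt = 1\<^sub>m n" using mat_mult_left_right_inverse[OF Pt P PP] .
  have sp: "x \<bullet> (P *\<^sub>v y) = (?Pt *\<^sub>v x) \<bullet> y" if "x \<in> carrier_vec n" "y \<in> carrier_vec n" for x y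
    using transpose_vec_mult_scalar[OF P that(2,1)] by simp
  show ?thesis
  \<comment> \<open>The witness is the transpose of the diagonalizing matrix: its rows are the
    eigenvectors, so it maps \<open>x\<close> to its eigenbasis coordinates.\<close>
  proof (intro exI[of _ ?Pt] conjI ballI)
    fix x :: "real vec" assume x: "x \<in> carrier_vec n"
    define y where "y = ?Pt *\<^sub>v x"
    have y: "y \<in> carrier_vec n" unfolding y_def using Pt x by simp
    have xy: "x = P *\<^sub>v y"
      unfolding y_def using P Pt x by (simp add: assoc_mult_mat_vec[symmetric] PP')
    have "x \<bullet> x = x \<bullet> (P *\<^sub>v y)" using xy by simp
    also have "\<dots> = y \<bullet> y" using sp[OF x y] y_def by simp
    also have "\<dots> = (\<Sum>j<n. (y $ j)\<^sup>2)"
      using y by (simp add: scalar_prod_def power2_eq_square lessThan_atLeast0)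
    finally show "x \<bullet> x = (\<Sum>j<n. ((?Pt *\<^sub>v x) $ j)\<^sup>2)" by (simp add: y_def)
    have "A = P * ?D * ?Pt"
    proof -
      have "P * ?D * ?Pt = (P * ?Pt) * A * (P * ?Pt)"
        unfolding D[symmetric] using P Pt A by (simp add: assoc_mult_mat[of _ n n _ n _ n])
      then show ?thesis using A by (simp add: PP')
    qed
    then have "A *\<^sub>v x = (P * ?D * ?Pt) *\<^sub>v x" by simp
    also have "\<dots> = P *\<^sub>v (?D *\<^sub>v y)"
      unfolding y_def using P Pt x
      by (simp add: assoc_mult_mat_vec[of _ n n _ n] mult_carrier_mat[of _ n n _ n])
    finally have "A *\<^sub>v x = P *\<^sub>v (?D *\<^sub>v y)" .
    then have "x \<bullet> (A *\<^sub>v x) = y \<bullet> (?D *\<^sub>v y)"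
      using sp[OF x mult_mat_vec_carrier[OF mat_diag_dim y]] by (simp add: y_def)
    also have "\<dots> = (\<Sum>j<n. y $ j * (eigval (Suc j) A * y $ j))"
      using y unfolding scalar_prod_def lessThan_atLeast0
      by (intro sum.cong)
        (auto simp: mat_diag_def scalar_prod_def if_distrib[of "\<lambda>a. a * _"] cong: if_cong)
    also have "\<dots> = (\<Sum>j<n. eigval (Suc j) A * (y $ j)\<^sup>2)"
      by (intro sum.cong) (auto simp: power2_eq_square)
    finally show "x \<bullet> (A *\<^sub>v x) = (\<Sum>j<n. eigval (Suc j) A * ((?Pt *\<^sub>v x) $ j)\<^sup>2)"
      by (simp add: y_def)
  qed (use P in simp)
qed

section \<open>Comparison of eigenvalues\<close>

text \<open>The hypothesis says that \<open>B + c I - A\<close> is positive semidefinite. With \<open>c = 0\<close> this is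
  monotonicity of the eigenvalues; general \<open>c\<close> gives Lipschitz continuity as well.\<close>

lemma eigval_le_add:
  assumes A: "A \<in> carrier_mat n n" "symmetric_mat A"
    and B: "B \<in> carrier_mat n n" "symmetric_mat B"
    and le: "\<And>x. x \<in> carrier_vec n \<Longrightarrow> x \<bullet> (A *\<^sub>v x) \<le> x \<bullet> (B *\<^sub>v x) + c * (x \<bullet> x)"
    and i: "i \<in> {1..n}"
  shows "eigval i A \<le> eigval i B + c"
proof -
  obtain P where P: "P \<in> carrier_mat n n"
    and Pn: "\<And>x. x \<in> carrier_vec n \<Longrightarrow> x \<bullet> x = (\<Sum>j<n. ((P *\<^sub>v x) $ j)\<^sup>2)"
    and PA: "\<And>x. x \<in> carrier_vec n \<Longrightarrow>
      x \<bullet> (A *\<^sub>v x) = (\<Sum>j<n. eigval (Suc j) A * ((P *\<^sub>v x) $ j)\<^sup>2)"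
    using quadratic_form_eigval[OF A] by blast
  obtain Q where Q: "Q \<in> carrier_mat n n"
    and Qn: "\<And>x. x \<in> carrier_vec n \<Longrightarrow> x \<bullet> x = (\<Sum>j<n. ((Q *\<^sub>v x) $ j)\<^sup>2)"
    and QB: "\<And>x. x \<in> carrier_vec n \<Longrightarrow>
      x \<bullet> (B *\<^sub>v x) = (\<Sum>j<n. eigval (Suc j) B * ((Q *\<^sub>v x) $ j)\<^sup>2)"
    using quadratic_form_eigval[OF B] by blast
  \<comment> \<open>A common nonzero vector of the span of the first \<open>i\<close> eigenvectors of \<open>A\<close> and the span of the
    last \<open>n - i + 1\<close> eigenvectors of \<open>B\<close> solves \<open>n - 1\<close> homogeneous equations; the \<open>i\<close>-th row of
    \<open>M\<close> is zero.\<close>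
  define M where "M = mat n n (\<lambda>(j, k). if Suc j < i then Q $$ (j, k)
    else if Suc j > i then P $$ (j, k) else 0)"
  have M: "M \<in> carrier_mat n n" by (simp add: M_def)
  have "i - 1 < n" using i by auto
  then have "det (mat\<^sub>r n n (\<lambda>j. if j = i - 1 then 0\<^sub>v n else row M j)) = 0"
    by (rule det_row_0) (use M in auto)
  moreover have "mat\<^sub>r n n (\<lambda>j. if j = i - 1 then 0\<^sub>v n else row M j) = M"
    using i by (intro eq_matI) (auto simp: M_def)
  ultimately have "det M = 0" by simp
  then obtain x where x: "x \<in> carrier_vec n" and x0: "x \<noteq> 0\<^sub>v n" and Mx: "M *\<^sub>v x = 0\<^sub>v n"
    using det_0_iff_vec_prod_zero[OF M] by blast
  have Mx': "(M *\<^sub>v x) $ j = 0" if "j < n" for j using Mx that by simp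
  \<comment> \<open>Rows count from 0 and eigenvalues from 1, so row \<open>j\<close> belongs to
    eigenvalue \<open>Suc j\<close>. The surviving coordinates of \<open>x\<close> have index at
    least \<open>i\<close> for \<open>B\<close> and at most \<open>i\<close> for
    \<open>A\<close>.\<close>
  have Qx: "(Q *\<^sub>v x) $ j = 0" if "j < n" "Suc j < i" for j
    using Mx'[OF that(1)] that x Q by (simp add: M_def scalar_prod_def)
  have Px: "(P *\<^sub>v x) $ j = 0" if "j < n" "Suc j > i" for j
    using Mx'[OF that(1)] that x P by (simp add: M_def scalar_prod_def)
  \<comment> \<open>Only eigenvalues of \<open>A\<close> that are at least the \<open>i\<close>-th
    carry weight in \<open>x\<close>; dually for \<open>B\<close> below, only those that are at most
    the \<open>i\<close>-th.\<close>
  have "eigval i A * (x \<bullet> x) \<le> x \<bullet> (A *\<^sub>v x)"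
    unfolding Pn[OF x] PA[OF x] sum_distrib_left
  proof (intro sum_mono)
    fix j assume j: "j \<in> {..<n}"
    show "eigval i A * ((P *\<^sub>v x) $ j)\<^sup>2 \<le> eigval (Suc j) A * ((P *\<^sub>v x) $ j)\<^sup>2"
      using eigval_diagonalization(2)[OF A, of "Suc j" i] Px[of j] i j
      by (cases "Suc j > i") (auto intro!: mult_right_mono)
  qed
  also have "\<dots> \<le> x \<bullet> (B *\<^sub>v x) + c * (x \<bullet> x)" by (rule le[OF x])
  also have "x \<bullet> (B *\<^sub>v x) \<le> eigval i B * (x \<bullet> x)"
    unfolding Qn[OF x] QB[OF x] sum_distrib_left
  proof (intro sum_mono)
    fix j assume j: "j \<in> {..<n}"
    show "eigval (Suc j) B * ((Q *\<^sub>v x) $ j)\<^sup>2 \<le> eigval i B * ((Q *\<^sub>v x) $ j)\<^sup>2"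
      using eigval_diagonalization(2)[OF B, of i "Suc j"] Qx[of j] i j
      by (cases "Suc j < i") (auto intro!: mult_right_mono)
  qed
  finally have "eigval i A * (x \<bullet> x) \<le> (eigval i B + c) * (x \<bullet> x)"
    by (simp add: algebra_simps)
  then show ?thesis using scalar_prod_self_pos[OF x x0] by simp
qed

text \<open>\<open>B - A\<close> is diagonal, so its quadratic form has no mixed terms. Sign and
  size of the change can thus be read off the diagonal entries.\<close>

lemma quadratic_form_diagonal_change:
  fixes A B :: "real mat"
  assumes A: "A \<in> carrier_mat n n" and B: "B \<in> carrier_mat n n" and x: "x \<in> carrier_vec n"
    and off: "\<And>i j. i < n \<Longrightarrow> j < n \<Longrightarrow> i \<noteq> j \<Longrightarrow> A $$ (i, j) = B $$ (i, j)"
  shows "x \<bullet> (B *\<^sub>v x) = x \<bullet> (A *\<^sub>v x) + (\<Sum>k<n. (B $$ (k, k) - A $$ (k, k)) * (x $ k)\<^sup>2)"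
proof -
  have *: "(B *\<^sub>v x) $ k = (A *\<^sub>v x) $ k + (B $$ (k, k) - A $$ (k, k)) * x $ k" if k: "k < n" for k
  proof -
    have "(B *\<^sub>v x) $ k - (A *\<^sub>v x) $ k = (\<Sum>j\<in>{0..<n}. (B $$ (k, j) - A $$ (k, j)) * x $ j)"
      using A B x k by (simp add: scalar_prod_def sum_subtractf[symmetric] algebra_simps)
    also have "\<dots> = (\<Sum>j\<in>{0..<n}. if j = k then (B $$ (k, k) - A $$ (k, k)) * x $ k else 0)"
      using off[of k] k by (intro sum.cong) auto
    finally show ?thesis using k by simp
  qed
  have "x \<bullet> (B *\<^sub>v x) =
      (\<Sum>k<n. x $ k * (A *\<^sub>v x) $ k + (B $$ (k, k) - A $$ (k, k)) * (x $ k)\<^sup>2)"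
    using B unfolding scalar_prod_def[of x] lessThan_atLeast0
    by (intro sum.cong) (auto simp: * distrib_left power2_eq_square simp del: index_mult_mat_vec)
  also have "\<dots> = x \<bullet> (A *\<^sub>v x) + (\<Sum>k<n. (B $$ (k, k) - A $$ (k, k)) * (x $ k)\<^sup>2)"
    using A by (simp add: scalar_prod_def lessThan_atLeast0 sum.distrib del: index_mult_mat_vec)
  finally show ?thesis .
qed

section \<open>The eigenvalue range of the interval matrix\<close>

theorem theorem17:
  fixes n i :: nat and L U :: "real mat"
  assumes "L \<in> carrier_mat n n" and "U \<in> carrier_mat n n"
    and "L \<le> U"
    and "diagonally_interval L U"
    and "symmetric_mat (midpoint_mat L U)"
    and "i \<in> {1..n}"
  shows "eigval i ` sym_part {L..U} = {eigval i L..eigval i U}"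
proof -
  note L = assms(1) and U = assms(2) and i = assms(6)
  have matD: "X $$ (j, k) \<le> Y $$ (j, k)"
    if "X \<le> Y" "Y \<in> carrier_mat n n" "j < n" "k < n" for X Y :: "real mat" and j k
    using that by (auto simp: less_eq_mat_def)
  note le = matD[OF assms(3) U]
  have off: "U $$ (j, k) = L $$ (j, k)" if "j < n" "k < n" "j \<noteq> k" for j k
    using assms(4) L U that
    by (auto simp: diagonally_interval_def diagonal_mat_def radius_mat_def)
  have "midpoint_mat L U \<in> carrier_mat n n" using L U by (simp add: midpoint_mat_def)
  note sym = assms(5)[unfolded symmetric_mat_index[OF this]]
  \<comment> \<open>Off the diagonal the radius vanishes and the midpoint coincides with
    \<open>L\<close>, so its symmetry passes to \<open>L\<close>, and from there to
    \<open>U\<close>.\<close>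
  have symL': "L $$ (j, k) = L $$ (k, j)" if jk: "j < n" "k < n" for j k
  proof (cases "j = k")
    case False
    have "midpoint_mat L U $$ (j, k) = L $$ (j, k)" "midpoint_mat L U $$ (k, j) = L $$ (k, j)"
      using off[OF jk False] off[OF jk(2,1)] False L U jk by (simp_all add: midpoint_mat_def)
    then show ?thesis using sym jk by metis
  qed simp
  have Lsym: "symmetric_mat L" unfolding symmetric_mat_index[OF L] using symL' by auto
  have Usym: "symmetric_mat U" unfolding symmetric_mat_index[OF U] using symL' off by metis
  have mono: "eigval i A \<le> eigval i B"
    if A: "A \<in> carrier_mat n n" "symmetric_mat A" and B: "B \<in> carrier_mat n n" "symmetric_mat B"
      and AB: "L \<le> A" "A \<le> B" "B \<le> U" for A B
  proof -
    have d: "A $$ (j, k) \<le> B $$ (j, k)" if "j < n" "k < n" for j k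
      using matD[OF AB(2) B(1) that] .
    \<comment> \<open>Off the diagonal \<open>A\<close> and \<open>B\<close> are squeezed between
      equal entries of \<open>L\<close> and \<open>U\<close>.\<close>
    have o: "A $$ (j, k) = B $$ (j, k)" if "j < n" "k < n" "j \<noteq> k" for j k
      using matD[OF AB(1) A(1) that(1,2)] d[OF that(1,2)] matD[OF AB(3) U that(1,2)] off[OF that]
      by linarith
    have "x \<bullet> (A *\<^sub>v x) \<le> x \<bullet> (B *\<^sub>v x) + 0 * (x \<bullet> x)" if x: "x \<in> carrier_vec n" for x
      using quadratic_form_diagonal_change[OF A(1) B(1) x o] d by (auto intro!: sum_nonneg)
    from eigval_le_add[OF A B this i] show ?thesis by simp
  qed
  \<comment> \<open>The segment from \<open>L\<close> to \<open>U\<close> stays symmetric for every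
    real \<open>t\<close> and lies in the interval matrix for \<open>t\<close> in [0, 1].\<close>
  define S where "S t = L + t \<cdot>\<^sub>m (U - L)" for t
  define f where "f t = eigval i (S t)" for t
  have S: "S t \<in> carrier_mat n n" for t using L U by (auto simp: S_def minus_mat_def)
  have S_index: "S t $$ (j, k) = L $$ (j, k) + t * (U $$ (j, k) - L $$ (j, k))"
    if "j < n" "k < n" for t j k
    using L U that by (simp add: S_def)
  have Ssym: "symmetric_mat (S t)" for t
    unfolding symmetric_mat_index[OF S] using symL' off S_index by metis
  have S0: "S 0 = L" using L U by (intro eq_matI) (auto simp: S_def)
  have S1: "S 1 = U" using L U by (intro eq_matI) (auto simp: S_def)
  have S_in: "S t \<in> {L..U}" if t: "0 \<le> t" "t \<le> 1" for t
  proof -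
    have "L $$ (j, k) \<le> S t $$ (j, k) \<and> S t $$ (j, k) \<le> U $$ (j, k)" if jk: "j < n" "k < n" for j k
    proof -
      let ?d = "U $$ (j, k) - L $$ (j, k)"
      have "0 \<le> t * ?d" "t * ?d \<le> ?d"
        using t le[OF jk] by (auto intro: mult_left_le_one_le)
      then show ?thesis using S_index[OF jk, of t] by linarith
    qed
    then show ?thesis using L U S[of t] by (auto simp: less_eq_mat_def)
  qed
  \<comment> \<open>The trace of \<open>U - L\<close>: as all diagonal gaps are nonnegative, their
    sum bounds each of them and serves as the Lipschitz constant.\<close>
  define C where "C = (\<Sum>k<n. U $$ (k, k) - L $$ (k, k))"
  have Ck: "U $$ (k, k) - L $$ (k, k) \<le> C" if "k < n" for k
    unfolding C_def using that le by (intro member_le_sum) auto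
  have C0: "0 \<le> C" unfolding C_def using le by (auto intro!: sum_nonneg)
  \<comment> \<open>Moving from \<open>t\<close> to \<open>s\<close> raises each diagonal entry by
    at most \<open>C * \<bar>s - t\<bar>\<close>, hence the quadratic form by at most that multiple
    of \<open>x \<bullet> x\<close>. Exchanging \<open>s\<close> and \<open>t\<close> later gives
    the two-sided bound.\<close>
  have lip: "f s \<le> f t + C * \<bar>s - t\<bar>" for s t
    unfolding f_def
  proof (rule eigval_le_add[OF S Ssym S Ssym _ i])
    fix x :: "real vec" assume x: "x \<in> carrier_vec n"
    have "x \<bullet> (S s *\<^sub>v x) =
        x \<bullet> (S t *\<^sub>v x) + (\<Sum>k<n. (S s $$ (k, k) - S t $$ (k, k)) * (x $ k)\<^sup>2)"
      by (rule quadratic_form_diagonal_change[OF S S x]) (simp add: S_index off)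
    also have "(\<Sum>k<n. (S s $$ (k, k) - S t $$ (k, k)) * (x $ k)\<^sup>2)
        \<le> (\<Sum>k<n. C * \<bar>s - t\<bar> * (x $ k)\<^sup>2)"
    proof (intro sum_mono mult_right_mono)
      fix k assume "k \<in> {..<n}"
      then have k: "k < n" by simp
      have "S s $$ (k, k) - S t $$ (k, k) = (U $$ (k, k) - L $$ (k, k)) * (s - t)"
        using k by (simp add: S_index algebra_simps)
      also have "\<dots> \<le> (U $$ (k, k) - L $$ (k, k)) * \<bar>s - t\<bar>"
        using le[OF k k] by (intro mult_left_mono) auto
      also have "\<dots> \<le> C * \<bar>s - t\<bar>"
        using Ck[OF k] by (intro mult_right_mono) auto
      finally show "S s $$ (k, k) - S t $$ (k, k) \<le> C * \<bar>s - t\<bar>" .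
    qed simp
    also have "\<dots> = C * \<bar>s - t\<bar> * (x \<bullet> x)"
      using x by (simp add: scalar_prod_def sum_distrib_left power2_eq_square lessThan_atLeast0)
    finally show "x \<bullet> (S s *\<^sub>v x) \<le> x \<bullet> (S t *\<^sub>v x) + C * \<bar>s - t\<bar> * (x \<bullet> x)" by simp
  qed
  have "isCont f t" for t
  proof -
    have "((\<lambda>s. s - t) \<longlongrightarrow> 0) (at t)"
      by (rule LIM_zero) (rule tendsto_ident_at)
    moreover have "norm (f s - f t) \<le> norm (s - t) * C" for s
      using lip[of s t] lip[of t s] by (simp add: abs_minus_commute abs_le_iff mult.commute)
    ultimately have "((\<lambda>s. f s - f t) \<longlongrightarrow> 0) (at t)"
      by (rule tendsto_0_le[OF _ always_eventually[OF allI]])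
    then show ?thesis
      unfolding isCont_def by (rule LIM_zero_cancel)
  qed
  then have cont: "continuous_on {0..1} f"
    by (simp add: continuous_at_imp_continuous_on)
  show ?thesis
  proof (intro equalityI subsetI)
    fix y assume "y \<in> eigval i ` sym_part {L..U}"
    then obtain A where A: "symmetric_mat A" "L \<le> A" "A \<le> U" and y: "y = eigval i A"
      by (auto simp: sym_part_def)
    have Ac: "A \<in> carrier_mat n n" using A L by (auto simp: less_eq_mat_def)
    show "y \<in> {eigval i L..eigval i U}"
      using mono[OF L Lsym Ac A(1)] mono[OF Ac A(1) U Usym] A y by simp
  next
    fix y assume "y \<in> {eigval i L..eigval i U}"
    then have "f 0 \<le> y" "y \<le> f 1" by (auto simp: f_def S0 S1)
    \<comment> \<open>The intermediate value theorem along the segment supplies a symmetric member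
      \<open>S t\<close> whose \<open>i\<close>-th eigenvalue is \<open>y\<close>.\<close>
    then obtain t where t: "0 \<le> t" "t \<le> 1" "f t = y"
      using IVT'[of f 0 y 1] cont by auto
    then show "y \<in> eigval i ` sym_part {L..U}"
      using S_in[OF t(1,2)] Ssym[of t] by (auto simp: sym_part_def f_def)
  qed
qed

end
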